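(* Let $b\geq 2$ be an integer and $n=2b$. Then $\mathrm{MiD}(L_{2,b})=b-1=\frac{n-2}{2}$.
   Context: A Latin square of order $n$ is an $n\times n$ array with entries from $\{1,2,\dots,n\}$ such that each row and each column contains every symbol exactly once. For positive integers $a,b$ and $n=ab$, an $(a,b)$-Sudoku Latin square is a Latin square of order $n$ such that, when the array is tiled by $a\times b$ blocks ($a$ consecutive rows $ka+1,\dots,(k+1)a$ by $b$ consecutive columns $lb+1,\dots,(l+1)b$), each block contains every symbol of $\{1,\dots,n\}$ exactly once. Two cells are adjacent if they share an edge horizontally or vertically (no wrap-around). The distance between two adjacent cells containing symbols $u,v$ is $\min\{(u-v)\bmod n,\ (v-u)\bmod n\}$, residues being taken in $\{0,\dots,n-1\}$. The inner distance of a Latin square of order $n\ge2$ is the minimum of the distances over all pairs of adjacent cells. $\mathrm{MiD}(L_{a,b})$ denotes the maximum of the inner distances of all $(a,b)$-Sudoku Latin squares. *)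

theory Defs
  imports Complex_Main
begin

(* An array is a function of the (1-based) row and column index; only its values on
   {1..n} x {1..n} matter. *)

definition latin_square :: "nat \<Rightarrow> (nat \<Rightarrow> nat \<Rightarrow> nat) \<Rightarrow> bool" where
  "latin_square n L \<longleftrightarrow>
     (\<forall>i\<in>{1..n}. bij_betw (\<lambda>j. L i j) {1..n} {1..n}) \<and>
     (\<forall>j\<in>{1..n}. bij_betw (\<lambda>i. L i j) {1..n} {1..n})"

(* Blocks have a rows and b columns, so an array of order a * b has b bands of rows
   and a bands of columns. *)
definition sudoku_latin_square :: "nat \<Rightarrow> nat \<Rightarrow> (nat \<Rightarrow> nat \<Rightarrow> nat) \<Rightarrow> bool" where
  "sudoku_latin_square a b L \<longleftrightarrow>
     latin_square (a * b) L \<and>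
     (\<forall>k<b. \<forall>l<a. bij_betw (\<lambda>(i, j). L i j)
        ({k * a + 1..(k + 1) * a} \<times> {l * b + 1..(l + 1) * b}) {1..a * b})"

definition adjacent_cells :: "nat \<times> nat \<Rightarrow> nat \<times> nat \<Rightarrow> bool" where
  "adjacent_cells p q \<longleftrightarrow>
     (fst p = fst q \<and> (snd q = snd p + 1 \<or> snd p = snd q + 1)) \<or>
     (snd p = snd q \<and> (fst q = fst p + 1 \<or> fst p = fst q + 1))"

(* Computed in int, where the residue mod n lies in {0..n-1} also for negative differences. *)
definition symbol_distance :: "nat \<Rightarrow> nat \<Rightarrow> nat \<Rightarrow> nat" where
  "symbol_distance n u v =
     nat (min ((int u - int v) mod int n) ((int v - int u) mod int n))"

(* The set is finite, and nonempty iff n >= 2. *)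
definition inner_distance :: "nat \<Rightarrow> (nat \<Rightarrow> nat \<Rightarrow> nat) \<Rightarrow> nat" where
  "inner_distance n L =
     Min {symbol_distance n (L i j) (L i' j') | i j i' j'.
            i \<in> {1..n} \<and> j \<in> {1..n} \<and> i' \<in> {1..n} \<and> j' \<in> {1..n} \<and>
            adjacent_cells (i, j) (i', j')}"

(* For a * b >= 2 all inner distances are less than a * b, so the set is finite. *)
definition MiD :: "nat \<Rightarrow> nat \<Rightarrow> nat" where
  "MiD a b = Max {inner_distance (a * b) L | L. sudoku_latin_square a b L}"

end

theory Submission
  imports Defs "HOL-Number_Theory.Cong"
begin

text \<open>
  On the cycle of \<open>n = 2 * b\<close> symbols no two symbols are further apart than \<open>b\<close>, and each symbol
  has exactly one antipode, at distance \<open>b\<close>. In three consecutive cells of a row the two outer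
  symbols differ, so they cannot both be the antipode of the middle one. This gives the
  upper bound \<open>b - 1\<close> (\<open>inner_distance_le\<close>).

  The bound is attained by a Cayley-table construction \<open>L i j = r i + c j\<close> modulo \<open>2 * b\<close>. Adjacent
  cells then differ by a step of \<open>r\<close> or of \<open>c\<close>, so each step has to be \<open>b\<close> or \<open>b - 1\<close> up to sign.
  The row offsets are \<open>0, b, 1, b + 1, 2, b + 2, \<dots>\<close> with steps \<open>b\<close> and \<open>1 - b\<close> in turn, and the
  two rows of a block differ by exactly \<open>b\<close>. Such a block
  contains every symbol once as soon as the column offsets used in it represent each residue class
  modulo \<open>b\<close> exactly once. In the left half the column offsets are the multiples \<open>(b - 1) * t\<close>
  for \<open>t < b\<close>, which do this since \<open>b - 1\<close> is congruent to \<open>- 1\<close> modulo \<open>b\<close>. The right half is the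
  left half shifted by \<open>b\<close> and read backwards: the shift supplies the missing symbols, and the
  reversal makes the step across the middle equal to \<open>b\<close>, whatever the parity of \<open>b\<close>.

  All injectivity claims (rows, columns, blocks) are thus instances of one fact,
  \<open>half_turn_representation_unique\<close>: for \<open>u\<close> coprime to \<open>b\<close>, the numbers \<open>u * t + b * e\<close> with
  \<open>t < b\<close> and \<open>e < 2\<close> are pairwise incongruent modulo \<open>2 * b\<close>.
\<close>

section \<open>Circular distance of symbols\<close>

lemma symbol_distance_eq:
  assumes "\<bar>int u - int v\<bar> < int n"
  shows "int (symbol_distance n u v) = min \<bar>int u - int v\<bar> (int n - \<bar>int u - int v\<bar>)"
proof -
  have neg: "(- d) mod int n = int n - d" if "0 < d" "d < int n" for d
    using that by (simp add: zmod_zminus1_eq_if)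
  consider "u = v" | "u < v" | "v < u" by linarith
  then show ?thesis
  proof cases
    case 2
    then show ?thesis
      using assms neg[of "int v - int u"] by (simp add: symbol_distance_def)
  next
    case 3
    then show ?thesis
      using assms neg[of "int u - int v"] by (simp add: symbol_distance_def)
  qed (use assms in \<open>simp add: symbol_distance_def\<close>)
qed

lemma symbol_distance_commute: "symbol_distance n u v = symbol_distance n v u"
  by (simp add: symbol_distance_def min.commute)

lemma symbol_distance_mod_Suc:
  "symbol_distance n (x mod n + 1) (y mod n + 1) = symbol_distance n x y"
  by (simp add: symbol_distance_def of_nat_mod mod_diff_eq)

section \<open>The upper bound\<close>

lemma finite_adjacent_distances:
  "finite {symbol_distance n (L i j) (L i' j') | i j i' j'.
     i \<in> {1..n} \<and> j \<in> {1..n} \<and> i' \<in> {1..n} \<and> j' \<in> {1..n} \<and> adjacent_cells (i, j) (i', j')}"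
  (is "finite ?D")
proof (rule finite_subset)
  show "?D \<subseteq> (\<lambda>(i, j, i', j'). symbol_distance n (L i j) (L i' j')) `
      ({1..n} \<times> {1..n} \<times> {1..n} \<times> {1..n})"
    by force
qed simp

lemma inner_distance_le_symbol_distance:
  assumes "i \<in> {1..n}" "j \<in> {1..n}" "i' \<in> {1..n}" "j' \<in> {1..n}"
    and "adjacent_cells (i, j) (i', j')"
  shows "inner_distance n L \<le> symbol_distance n (L i j) (L i' j')"
  unfolding inner_distance_def
  by (rule Min_le[OF finite_adjacent_distances]) (use assms in blast)

lemma le_inner_distance:
  assumes "n \<ge> 2"
    and "\<And>i j i' j'. \<lbrakk>i \<in> {1..n}; j \<in> {1..n}; i' \<in> {1..n}; j' \<in> {1..n};
           adjacent_cells (i, j) (i', j')\<rbrakk> \<Longrightarrow> m \<le> symbol_distance n (L i j) (L i' j')"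
  shows "m \<le> inner_distance n L"
  unfolding inner_distance_def
proof (rule Min.boundedI[OF finite_adjacent_distances])
  have "adjacent_cells (1, 1) (1, 2)"
    by (simp add: adjacent_cells_def)
  then show "{symbol_distance n (L i j) (L i' j') | i j i' j'.
     i \<in> {1..n} \<and> j \<in> {1..n} \<and> i' \<in> {1..n} \<and> j' \<in> {1..n} \<and> adjacent_cells (i, j) (i', j')} \<noteq> {}"
    using \<open>n \<ge> 2\<close> by fastforce
qed (use assms(2) in blast)

lemma antipode_unique:
  assumes "u \<in> {1..2 * b}" "v \<in> {1..2 * b}" "w \<in> {1..2 * b}"
    and "b \<le> symbol_distance (2 * b) u v" "b \<le> symbol_distance (2 * b) v w"
  shows "u = w"
proof -
  have antipode: "\<bar>int x - int y\<bar> = int b"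
    if "x \<in> {1..2 * b}" "y \<in> {1..2 * b}" "b \<le> symbol_distance (2 * b) x y" for x y
  proof -
    have "\<bar>int x - int y\<bar> < int (2 * b)"
      using that by auto
    then show ?thesis
      using symbol_distance_eq[of x y "2 * b"] that(3) by linarith
  qed
  have "\<bar>int u - int v\<bar> = int b" "\<bar>int v - int w\<bar> = int b"
    using assms by (simp_all add: antipode)
  then show ?thesis
    using assms(1-3) by auto
qed

lemma inner_distance_le:
  assumes "b \<ge> 2" and "latin_square (2 * b) L"
  shows "inner_distance (2 * b) L \<le> b - 1"
proof (rule ccontr)
  assume "\<not> ?thesis"
  then have large: "b \<le> inner_distance (2 * b) L"
    by simp
  have "adjacent_cells (1, 1) (1, 2)" "adjacent_cells (1, 2) (1, 3)"
    by (simp_all add: adjacent_cells_def)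
  then have "b \<le> symbol_distance (2 * b) (L 1 1) (L 1 2)"
    and "b \<le> symbol_distance (2 * b) (L 1 2) (L 1 3)"
    using inner_distance_le_symbol_distance[of 1 "2 * b" 1 1 2 L]
      inner_distance_le_symbol_distance[of 1 "2 * b" 2 1 3 L] large \<open>b \<ge> 2\<close> by auto
  moreover have row: "bij_betw (\<lambda>j. L 1 j) {1..2 * b} {1..2 * b}"
    using assms unfolding latin_square_def by auto
  then have "L 1 1 \<in> {1..2 * b}" "L 1 2 \<in> {1..2 * b}" "L 1 3 \<in> {1..2 * b}"
    using bij_betwE[OF row] \<open>b \<ge> 2\<close> by auto
  ultimately have "L 1 1 = L 1 3"
    by (intro antipode_unique)
  then have "(1::nat) = 3"
    using inj_onD[OF bij_betw_imp_inj_on[OF row], of 1 3] \<open>b \<ge> 2\<close> by auto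
  then show False
    by simp
qed

section \<open>Representing residues by half-turns\<close>

text \<open>
  Modulo \<open>b\<close> the half-turns vanish, which determines \<open>t\<close> because \<open>u\<close> is invertible; the residue
  of \<open>b * e\<close> modulo \<open>2 * b\<close> then determines the parity of \<open>e\<close>.
\<close>
lemma half_turn_representation_unique:
  fixes b u t t' e e' c :: nat
  assumes "coprime u b" "t < b" "t' < b" "e < 2" "e' < 2"
    and "[c + (u * t + b * e) = c + (u * t' + b * e')] (mod 2 * b)"
  shows "t = t' \<and> e = e'"
proof -
  have cong: "[u * t + b * e = u * t' + b * e'] (mod 2 * b)"
    using assms(6) by (simp add: cong_add_lcancel_nat)
  then have "[u * t + b * e = u * t' + b * e'] (mod b)"
    by (rule cong_dvd_modulus_nat) simp
  then have "[u * t = u * t'] (mod b)"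
    by (simp add: cong_def)
  then have "[t = t'] (mod b)"
    using assms(1) by (simp add: cong_mult_lcancel_nat)
  then have t: "t = t'"
    using assms(2,3) by (simp add: cong_def)
  then have "[b * e = b * e'] (mod b * 2)"
    using cong by (simp add: cong_add_lcancel_nat mult.commute)
  then have "b * (e mod 2) = b * (e' mod 2)"
    by (simp add: cong_def)
  then have "e = e'"
    using assms(2,4,5) by simp
  with t show ?thesis ..
qed

text \<open>
  Rows, columns and blocks all have \<open>2 * b\<close> cells, so by counting it suffices that distinct cells
  carry distinct symbols. With suitable coordinates \<open>t\<close> and \<open>e\<close> of a cell this is
  \<open>half_turn_representation_unique\<close>.
\<close>
lemma bij_betw_half_turns:
  fixes f :: "'a \<Rightarrow> nat"
  assumes "b > 0" "coprime u b" "finite A" "card A = 2 * b"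
    and f: "\<And>x. x \<in> A \<Longrightarrow> f x = (c + (u * t x + b * e x)) mod (2 * b) + 1"
    and t: "\<And>x. x \<in> A \<Longrightarrow> t x < b" and e: "\<And>x. x \<in> A \<Longrightarrow> e x < 2"
    and inj: "inj_on (\<lambda>x. (t x, e x)) A"
  shows "bij_betw f A {1..2 * b}"
proof -
  have inj_f: "inj_on f A"
  proof (rule inj_onI)
    fix x y
    assume xy: "x \<in> A" "y \<in> A" "f x = f y"
    then have "[c + (u * t x + b * e x) = c + (u * t y + b * e y)] (mod 2 * b)"
      using f by (simp add: cong_def)
    then have "t x = t y \<and> e x = e y"
      using half_turn_representation_unique assms(2) t e xy by blast
    then show "x = y"
      using inj xy by (auto dest: inj_onD)
  qed
  have "f ` A \<subseteq> {1..2 * b}"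
    using f \<open>b > 0\<close> by (auto simp: Suc_le_eq)
  then have "f ` A = {1..2 * b}"
    by (rule card_subset_eq[rotated]) (simp_all add: card_image[OF inj_f] assms(4))
  with inj_f show ?thesis
    by (simp add: bij_betw_def)
qed

section \<open>The extremal square\<close>

text \<open>The offsets take indices counted from \<open>0\<close>, whereas the cells of the square count from \<open>1\<close>.\<close>
definition row_offset :: "nat \<Rightarrow> nat \<Rightarrow> nat" where
  "row_offset b i = i div 2 + b * (i mod 2)"

text \<open>Columns \<open>j\<close> and \<open>2 * b - 1 - j\<close> share an index: the right half mirrors the left half.\<close>
definition fold_index :: "nat \<Rightarrow> nat \<Rightarrow> nat" where
  "fold_index b j = (if j < b then j else 2 * b - 1 - j)"

definition column_offset :: "nat \<Rightarrow> nat \<Rightarrow> nat" where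
  "column_offset b j = (b - 1) * fold_index b j + b * (j div b)"

definition extremal_square :: "nat \<Rightarrow> nat \<Rightarrow> nat \<Rightarrow> nat" where
  "extremal_square b i j =
     (row_offset b (i - 1) + column_offset b (j - 1)) mod (2 * b) + 1"

lemma fold_index_less: "j < 2 * b \<Longrightarrow> fold_index b j < b"
  by (auto simp: fold_index_def)

lemma div_eq_if_less_double: "j < 2 * b \<Longrightarrow> j div b = (if j < b then 0 else (1::nat))"
  by (simp add: div_nat_eqI)

lemma fold_coordinates_inject:
  assumes "j < 2 * b" "j' < 2 * b" "fold_index b j = fold_index b j'" "j div b = j' div b"
  shows "j = j'"
proof -
  have "j < b \<longleftrightarrow> j' < b"
    using assms(4) unfolding div_eq_if_less_double[OF assms(1)] div_eq_if_less_double[OF assms(2)]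
    by (simp split: if_splits)
  then show ?thesis
    using assms(1-3) unfolding fold_index_def by (cases "j < b") simp_all
qed

lemma coprime_pred_self:
  fixes b :: nat
  assumes "b > 0"
  shows "coprime (b - 1) b"
  using assms coprime_diff_one_left_nat by blast

lemma extremal_square_row:
  assumes "b > 0"
  shows "bij_betw (extremal_square b i) {1..2 * b} {1..2 * b}"
proof (rule bij_betw_half_turns[OF assms coprime_pred_self[OF assms],
      where c = "row_offset b (i - 1)"
      and t = "\<lambda>j. fold_index b (j - 1)" and e = "\<lambda>j. (j - 1) div b"])
  have less: "j - 1 < 2 * b" if "j \<in> {1..2 * b}" for j
    using that by auto
  show "fold_index b (j - 1) < b" if "j \<in> {1..2 * b}" for j
    using less[OF that] by (rule fold_index_less)
  show "(j - 1) div b < 2" if "j \<in> {1..2 * b}" for j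
    using less[OF that] by (rule less_mult_imp_div_less)
  show "inj_on (\<lambda>j. (fold_index b (j - 1), (j - 1) div b)) {1..2 * b}"
  proof (rule inj_onI)
    fix j j'
    assume j: "j \<in> {1..2 * b}" "j' \<in> {1..2 * b}"
      and "(fold_index b (j - 1), (j - 1) div b) = (fold_index b (j' - 1), (j' - 1) div b)"
    then have "j - 1 = j' - 1"
      using fold_coordinates_inject[OF less[OF j(1)] less[OF j(2)]] by simp
    then show "j = j'"
      using j by auto
  qed
qed (simp_all add: extremal_square_def column_offset_def)

lemma extremal_square_column:
  assumes "b > 0"
  shows "bij_betw (\<lambda>i. extremal_square b i j) {1..2 * b} {1..2 * b}"
proof (rule bij_betw_half_turns[where c = "column_offset b (j - 1)" and u = 1
      and t = "\<lambda>i. (i - 1) div 2" and e = "\<lambda>i. (i - 1) mod 2"])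
  show "inj_on (\<lambda>i. ((i - 1) div 2, (i - 1) mod 2)) {1..2 * b}"
  proof (rule inj_onI)
    fix i i'
    assume i: "i \<in> {1..2 * b}" "i' \<in> {1..2 * b}"
      and "((i - 1) div 2, (i - 1) mod 2) = ((i' - 1) div 2, (i' - 1) mod 2)"
    then have "i - 1 = i' - 1"
      by (metis div_mult_mod_eq prod.inject)
    then show "i = i'"
      using i by auto
  qed
  show "(i - 1) div 2 < b" if "i \<in> {1..2 * b}" for i
    using that by (intro less_mult_imp_div_less) auto
  show "extremal_square b i j =
      (column_offset b (j - 1) + (1 * ((i - 1) div 2) + b * ((i - 1) mod 2))) mod (2 * b) + 1" for i
    unfolding extremal_square_def row_offset_def mult_1 by (simp only: add.commute)
qed (use assms in simp_all)

text \<open>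
  Inside a block the band indices \<open>k\<close> and \<open>l\<close> are constant and only contribute to the shift \<open>c\<close>;
  the half-turn comes from the choice between the two rows.
\<close>
lemma extremal_square_block:
  assumes "b > 0" "l < 2"
  shows "bij_betw (\<lambda>(i, j). extremal_square b i j)
    ({k * 2 + 1..(k + 1) * 2} \<times> {l * b + 1..(l + 1) * b}) {1..2 * b}"
    (is "bij_betw _ (?R \<times> ?C) _")
proof -
  have row: "(i - 1) div 2 = k" if "i \<in> ?R" for i
  proof (rule div_nat_eqI)
    show "2 * k \<le> i - 1" "i - 1 < 2 * Suc k"
      using that by auto
  qed
  have col: "(j - 1) div b = l" if "j \<in> ?C" for j
  proof (rule div_nat_eqI)
    have "l * b + 1 \<le> j" "j \<le> l * b + b"
      using that by simp_all
    then show "b * l \<le> j - 1" "j - 1 < b * Suc l"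
      by (simp_all add: mult.commute)
  qed
  have less: "j - 1 < 2 * b" if "j \<in> ?C" for j
  proof -
    have "l * b \<le> 1 * b"
      using assms by (intro mult_right_mono) auto
    moreover have "1 \<le> j" "j \<le> l * b + b"
      using that by simp_all
    ultimately show ?thesis
      by linarith
  qed
  show ?thesis
  proof (rule bij_betw_half_turns[OF assms(1) coprime_pred_self[OF assms(1)],
        where c = "k + b * l"
        and t = "\<lambda>x. fold_index b (snd x - 1)" and e = "\<lambda>x. (fst x - 1) mod 2"])
    show "inj_on (\<lambda>x. (fold_index b (snd x - 1), (fst x - 1) mod 2)) (?R \<times> ?C)"
    proof (rule inj_onI)
      fix x y
      assume x: "x \<in> ?R \<times> ?C" and y: "y \<in> ?R \<times> ?C"
        and eq: "(fold_index b (snd x - 1), (fst x - 1) mod 2) =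
          (fold_index b (snd y - 1), (fst y - 1) mod 2)"
      have in_R: "fst x \<in> ?R" "fst y \<in> ?R" and in_C: "snd x \<in> ?C" "snd y \<in> ?C"
        using x y by (simp_all only: mem_Times_iff)
      have "snd x - 1 = snd y - 1"
        using less[OF in_C(1)] less[OF in_C(2)]
      proof (rule fold_coordinates_inject)
        show "fold_index b (snd x - 1) = fold_index b (snd y - 1)"
          using eq by (simp only: prod.inject)
        show "(snd x - 1) div b = (snd y - 1) div b"
          by (simp only: col[OF in_C(1)] col[OF in_C(2)])
      qed
      moreover have "fst x - 1 = fst y - 1"
      proof -
        have "(fst x - 1) mod 2 = (fst y - 1) mod 2"
          using eq by (simp only: prod.inject)
        then show ?thesis
          using div_mult_mod_eq[of "fst x - 1" 2] div_mult_mod_eq[of "fst y - 1" 2]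
          unfolding row[OF in_R(1)] row[OF in_R(2)] by linarith
      qed
      moreover have "1 \<le> fst x" "1 \<le> fst y" "1 \<le> snd x" "1 \<le> snd y"
        using in_R in_C by simp_all
      ultimately show "x = y"
        unfolding prod_eq_iff by linarith
    qed
    show "(case x of (i, j) \<Rightarrow> extremal_square b i j) =
        (k + b * l + ((b - 1) * fold_index b (snd x - 1) + b * ((fst x - 1) mod 2)))
          mod (2 * b) + 1" if "x \<in> ?R \<times> ?C" for x
    proof -
      have in_R: "fst x \<in> ?R" and in_C: "snd x \<in> ?C"
        using that by (simp_all only: mem_Times_iff)
      show ?thesis
        unfolding extremal_square_def row_offset_def column_offset_def case_prod_beta
          row[OF in_R] col[OF in_C] by (simp only: ac_simps)
    qed
    show "fold_index b (snd x - 1) < b" if "x \<in> ?R \<times> ?C" for x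
      using that by (intro fold_index_less less) (simp only: mem_Times_iff)
  qed simp_all
qed

lemma sudoku_extremal_square:
  assumes "b > 0"
  shows "sudoku_latin_square 2 b (extremal_square b)"
  unfolding sudoku_latin_square_def latin_square_def
  using extremal_square_row[OF assms] extremal_square_column[OF assms]
    extremal_square_block[OF assms] by blast

lemma row_offset_step:
  "int (row_offset b (Suc i)) - int (row_offset b i) \<in> {int b, 1 - int b}"
proof (cases "even i")
  case True
  then show ?thesis
    by (auto simp: row_offset_def elim!: evenE)
next
  case False
  then show ?thesis
    by (auto simp: row_offset_def elim!: oddE)
qed

lemma column_offset_step:
  assumes "Suc j < 2 * b"
  shows "int (column_offset b (Suc j)) - int (column_offset b j)
    \<in> {int b, int b - 1, 1 - int b}"
proof -
  consider "Suc j < b" | "Suc j = b" | "b \<le> j" by linarith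
  then show ?thesis
  proof cases
    case 1
    then show ?thesis
      by (simp add: column_offset_def fold_index_def of_nat_diff algebra_simps)
  next
    case 2
    \<comment> \<open>Across the middle the folded index repeats, so only the added half-turn remains.\<close>
    then show ?thesis
      using assms by (auto simp: column_offset_def fold_index_def)
  next
    case 3
    define s where "s = 2 * b - 1 - Suc j"
    have "fold_index b (Suc j) = s" "fold_index b j = Suc s"
      using 3 assms by (auto simp: fold_index_def s_def)
    moreover have "Suc j div b = 1" "j div b = 1"
      using 3 assms by (simp_all add: div_eq_if_less_double)
    ultimately show ?thesis
      using assms by (cases b) (simp_all add: column_offset_def algebra_simps)
  qed
qed

lemma le_symbol_distance_half_turn:
  assumes "b > 0" and "int x - int y \<in> {int b, int b - 1, 1 - int b}"
  shows "b - 1 \<le> symbol_distance (2 * b) (x mod (2 * b) + 1) (y mod (2 * b) + 1)"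
proof -
  have "int b - 1 \<le> \<bar>int x - int y\<bar>" "\<bar>int x - int y\<bar> \<le> int b"
    using assms by auto
  then have "int b - 1 \<le> int (symbol_distance (2 * b) x y)"
    using assms(1) by (subst symbol_distance_eq) auto
  then show ?thesis
    unfolding symbol_distance_mod_Suc by linarith
qed

lemma inner_distance_extremal_square_ge:
  assumes "b \<ge> 2"
  shows "b - 1 \<le> inner_distance (2 * b) (extremal_square b)"
proof (rule le_inner_distance)
  let ?E = "extremal_square b"
  have down: "b - 1 \<le> symbol_distance (2 * b) (?E (i + 1) j) (?E i j)" if "1 \<le> i" for i j
    unfolding extremal_square_def
    by (rule le_symbol_distance_half_turn)
      (use assms that row_offset_step[of b "i - 1"] in auto)
  have right: "b - 1 \<le> symbol_distance (2 * b) (?E i (j + 1)) (?E i j)"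
    if "1 \<le> j" "j + 1 \<le> 2 * b" for i j
    unfolding extremal_square_def
    by (rule le_symbol_distance_half_turn)
      (use assms that column_offset_step[of "j - 1" b] in auto)
  fix i j i' j'
  assume "i \<in> {1..2 * b}" "j \<in> {1..2 * b}" "i' \<in> {1..2 * b}" "j' \<in> {1..2 * b}"
    "adjacent_cells (i, j) (i', j')"
  then show "b - 1 \<le> symbol_distance (2 * b) (?E i j) (?E i' j')"
    using down[of i j] down[of i' j] right[of j i] right[of j' i]
    by (auto simp: adjacent_cells_def symbol_distance_commute)
qed (use assms in simp)

section \<open>The maximum inner distance\<close>

theorem theorem4p2:
  fixes b n :: nat
  assumes "b \<ge> 2" and "n = 2 * b"
  shows "real (MiD 2 b) = real b - 1 \<and> real b - 1 = (real n - 2) / 2"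
proof -
  let ?S = "{inner_distance (2 * b) L | L. sudoku_latin_square 2 b L}"
  have upper: "m \<le> b - 1" if "m \<in> ?S" for m
    using that inner_distance_le[OF assms(1)] by (auto simp: sudoku_latin_square_def)
  have sudoku: "sudoku_latin_square 2 b (extremal_square b)"
    using assms(1) by (intro sudoku_extremal_square) simp
  have "inner_distance (2 * b) (extremal_square b) = b - 1"
    using inner_distance_extremal_square_ge[OF assms(1)] upper
      sudoku by (intro antisym) blast+
  then have "b - 1 \<in> ?S"
    using sudoku by force
  moreover have "finite ?S"
    by (rule finite_subset[of _ "{..b - 1}"]) (use upper in blast)+
  ultimately have "MiD 2 b = b - 1"
    unfolding MiD_def using upper by (intro Max_eqI)
  then show ?thesis
    using assms by (simp add: of_nat_diff field_simps)
qed

end
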